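(* Let $G$ be a finite connected undirected multigraph (multiple edges and loops allowed). Let $D$ be a spanning mixed multigraph obtained from $G$ by deleting some (possibly no) edges and orienting some (possibly no) of the non-loop edges so that no digons are created. Let $n=|V(D)|$. The following statements are equivalent: (a) $G$ and $D$ are $H$-antispectral. (b) $\lambda_1(G)=-\lambda_n(D)$. (c) None of the edges have been deleted, i.e., $G(D)=G$, and there exists a partition of the vertex-set of $D$ into four (possibly empty) parts $V_1,V_{-1},V_i,V_{-i}$ such that the following holds: for each $j\in\{1,-1,i,-i\}$, $V_j$ is an independent set in $G$ (no edges, and in particular no loops, inside $V_j$); for each $j\in\{1,-1,i,-i\}$, every edge of $D$ with one end in $V_j$ and one end in $V_{-j}$ is undirected; and every other edge of $D$ is an arc $(u,v)$ (directed from $u$ to $v$) such that $u\in V_j$ and $v\in V_{ij}$ for some $j\in\{1,-1,i,-i\}$, where $ij$ denotes the product of the complex numbers $i$ and $j$.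
   Context: A mixed multigraph $D$ consists of a finite vertex-set $V=V(D)$ together with undirected edges (loops and parallel edges allowed) and directed edges (arcs) $(x,y)$, $x\ne y$, from $x$ to $y$ (parallel arcs allowed). A digon is a pair of arcs joining the same two vertices in opposite directions; mixed multigraphs considered here contain no digons. An undirected multigraph is a mixed multigraph with no arcs. The underlying multigraph $G(D)$ is obtained by replacing each arc by an undirected edge. The Hermitian adjacency matrix $H(D)\in\mathbb{C}^{V\times V}$ has as $(u,v)$-entry the sum of the contributions of all edges joining $u$ and $v$: for $u\neq v$, each undirected edge joining $u$ and $v$ contributes $1$, each arc from $u$ to $v$ contributes the imaginary unit $i$ and each arc from $v$ to $u$ contributes $-i$; each loop at $v$ contributes $1$ to the entry $H(D)_{vv}$. The matrix $H(D)$ is Hermitian; its eigenvalues (with multiplicity) are $\lambda_1(D)\ge\lambda_2(D)\ge\dots\ge\lambda_n(D)$, $n=|V(D)|$, and are called the $H$-eigenvalues of $D$. Two mixed multigraphs $D$ and $D'$ with the same number of vertices are $H$-antispectral if for each $H$-eigenvalue $\lambda$ of $D$ of multiplicity $k$, $-\lambda$ is an $H$-eigenvalue of $D'$ with the same multiplicity $k$. *)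

theory Defs
  imports "HOL-Library.Multiset" "HOL-Library.Uprod" "HOL-Library.Disjoint_Sets"
    "HOL-Computational_Algebra.Fundamental_Theorem_Algebra"
    "Jordan_Normal_Form.Char_Poly"
begin

section \<open>Mixed multigraphs\<close>

text \<open>
  Parallel edges are multiplicities in a multiset. An undirected edge is an unordered pair of its
  ends, a loop at \<open>v\<close> being \<open>Upair v v\<close>; an arc from \<open>x\<close> to \<open>y\<close> is the ordered pair \<open>(x, y)\<close>.
\<close>

record 'v mixed_multigraph =
  verts :: "'v set"
  edges :: "'v uprod multiset"
  arcs :: "('v \<times> 'v) multiset"

text \<open>The last condition says that there are no digons.\<close>

definition mixed_multigraph :: "'v mixed_multigraph \<Rightarrow> bool" where
  "mixed_multigraph D \<longleftrightarrow>
     finite (verts D) \<and>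
     (\<forall>e \<in># edges D. set_uprod e \<subseteq> verts D) \<and>
     (\<forall>(x, y) \<in># arcs D. x \<in> verts D \<and> y \<in> verts D \<and> x \<noteq> y) \<and>
     (\<forall>x y. \<not> ((x, y) \<in># arcs D \<and> (y, x) \<in># arcs D))"

definition undirected_multigraph :: "'v mixed_multigraph \<Rightarrow> bool" where
  "undirected_multigraph G \<longleftrightarrow> mixed_multigraph G \<and> arcs G = {#}"

definition underlying :: "'v mixed_multigraph \<Rightarrow> 'v mixed_multigraph" where
  "underlying D =
     \<lparr>verts = verts D,
      edges = edges D + image_mset (\<lambda>(x, y). Upair x y) (arcs D),
      arcs = {#}\<rparr>"

text \<open>The empty graph does not count as connected.\<close>

definition connected_multigraph :: "'v mixed_multigraph \<Rightarrow> bool" where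
  "connected_multigraph D \<longleftrightarrow>
     verts D \<noteq> {} \<and>
     (\<forall>u \<in> verts D. \<forall>v \<in> verts D. (u, v) \<in> {(x, y). Upair x y \<in># edges (underlying D)}\<^sup>*)"

text \<open>
  \<open>D\<close> arises from the undirected multigraph \<open>G\<close> by deleting some edges (those of \<open>G\<close> missing from
  the underlying multigraph of \<open>D\<close>) and orienting some of the non-loop edges that remain. That no
  loop is oriented and no digon is created is part of \<^term>\<open>mixed_multigraph D\<close>.
\<close>

definition delete_orient :: "'v mixed_multigraph \<Rightarrow> 'v mixed_multigraph \<Rightarrow> bool" where
  "delete_orient G D \<longleftrightarrow>
     mixed_multigraph D \<and> verts D = verts G \<and> edges (underlying D) \<subseteq># edges G"


section \<open>Hermitian adjacency matrix and spectrum\<close>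

text \<open>No case distinction is needed at \<open>u = v\<close>, because the two arc terms then cancel.\<close>

definition H_entry :: "'v mixed_multigraph \<Rightarrow> 'v \<Rightarrow> 'v \<Rightarrow> complex" where
  "H_entry D u v =
     of_nat (count (edges D) (Upair u v))
     + \<i> * of_nat (count (arcs D) (u, v))
     - \<i> * of_nat (count (arcs D) (v, u))"

definition H_mat_of :: "'v mixed_multigraph \<Rightarrow> 'v list \<Rightarrow> complex mat" where
  "H_mat_of D vs = mat (length vs) (length vs) (\<lambda>(i, j). H_entry D (vs ! i) (vs ! j))"

text \<open>
  Library matrices have rows and columns numbered from 0, so the vertices are enumerated in an
  arbitrary fixed order; by \<open>char_poly_H_mat\<close> below, the spectrum does not depend on that order.
\<close>

definition vertex_list :: "'v set \<Rightarrow> 'v list" where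
  "vertex_list V = (SOME vs. distinct vs \<and> set vs = V)"

definition H_mat :: "'v mixed_multigraph \<Rightarrow> complex mat" where
  "H_mat D = H_mat_of D (vertex_list (verts D))"

definition H_multiplicity :: "'v mixed_multigraph \<Rightarrow> complex \<Rightarrow> nat" where
  "H_multiplicity D x = order x (char_poly (H_mat D))"

text \<open>
  The eigenvalues with multiplicity in decreasing order. They are real, so that nothing is lost
  by \<open>Re\<close>; see \<open>mset_H_spectrum\<close> below.
\<close>

definition H_spectrum :: "'v mixed_multigraph \<Rightarrow> real list" where
  "H_spectrum D = rev (sorted_list_of_multiset (image_mset Re (proots (char_poly (H_mat D)))))"

text \<open>The numbering of the eigenvalues starts at 1.\<close>

definition H_eigenvalue :: "nat \<Rightarrow> 'v mixed_multigraph \<Rightarrow> real" where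
  "H_eigenvalue k D = H_spectrum D ! (k - 1)"

definition H_antispectral :: "'v mixed_multigraph \<Rightarrow> 'w mixed_multigraph \<Rightarrow> bool" where
  "H_antispectral D D' \<longleftrightarrow>
     card (verts D) = card (verts D') \<and>
     (\<forall>x. eigenvalue (H_mat D) x \<longrightarrow>
        eigenvalue (H_mat D') (- x) \<and> H_multiplicity D' (- x) = H_multiplicity D x)"


section \<open>The four-part partition\<close>

definition units4 :: "complex set" where
  "units4 = {1, -1, \<i>, -\<i>}"

text \<open>One end in \<open>V\<^sub>j\<close> and the other in \<open>V\<^sub>-\<^sub>j\<close>; symmetric in \<open>u\<close> and \<open>v\<close> as \<open>j\<close> ranges over \<open>units4\<close>.\<close>

definition opposite :: "(complex \<Rightarrow> 'v set) \<Rightarrow> 'v \<Rightarrow> 'v \<Rightarrow> bool" where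
  "opposite P u v \<longleftrightarrow> (\<exists>j \<in> units4. u \<in> P j \<and> v \<in> P (- j))"

text \<open>
  The part \<open>V\<^sub>j\<close> is \<open>P j\<close>. The clauses on \<open>D\<close> say, in order: no edge between opposite parts is an
  arc; every undirected edge runs between opposite parts; every arc not between opposite parts
  leads from some \<open>V\<^sub>j\<close> to the part of index \<open>\<i> * j\<close>.
\<close>

definition four_partition ::
  "'v mixed_multigraph \<Rightarrow> 'v mixed_multigraph \<Rightarrow> (complex \<Rightarrow> 'v set) \<Rightarrow> bool" where
  "four_partition G D P \<longleftrightarrow>
     (\<Union>j\<in>units4. P j) = verts D \<and> disjoint_family_on P units4 \<and>
     (\<forall>j\<in>units4. \<forall>u\<in>P j. \<forall>v\<in>P j. Upair u v \<notin># edges G) \<and>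
     (\<forall>(u, v) \<in># arcs D. \<not> opposite P u v) \<and>
     (\<forall>u v. Upair u v \<in># edges D \<longrightarrow> opposite P u v) \<and>
     (\<forall>(u, v) \<in># arcs D. \<not> opposite P u v \<longrightarrow> (\<exists>j\<in>units4. u \<in> P j \<and> v \<in> P (\<i> * j)))"


section \<open>Well-definedness of the spectrum\<close>

lemma vertex_list:
  assumes "finite V"
  shows "distinct (vertex_list V)" "set (vertex_list V) = V" "length (vertex_list V) = card V"
proof -
  have "distinct (vertex_list V) \<and> set (vertex_list V) = V"
    unfolding vertex_list_def
    by (rule someI_ex) (use finite_distinct_list[OF assms] in blast)
  then show "distinct (vertex_list V)" "set (vertex_list V) = V" "length (vertex_list V) = card V"
    by (auto simp: distinct_card[symmetric])
qed

lemma H_mat_carrier: "finite (verts D) \<Longrightarrow> H_mat D \<in> carrier_mat (card (verts D)) (card (verts D))"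
  by (simp add: H_mat_def H_mat_of_def vertex_list)

lemma H_entry_cnj: "cnj (H_entry D u v) = H_entry D v u"
proof -
  have "Upair v u = Upair u v" by (simp only: Upair_inject) simp
  then have "count (edges D) (Upair v u) = count (edges D) (Upair u v)" by (rule arg_cong)
  then show ?thesis by (simp only: H_entry_def) simp
qed

lemma char_poly_H_mat_of_permute:
  fixes D :: "'v mixed_multigraph"
  assumes "distinct vs" "distinct ws" "set vs = set ws"
  shows "char_poly (H_mat_of D vs) = char_poly (H_mat_of D ws)"
proof -
  define n where "n = length vs"
  have n: "length ws = n"
    using assms distinct_card n_def by metis
  have "mset vs = mset ws"
    using assms set_eq_iff_mset_eq_distinct by blast
  then obtain p where p: "p permutes {..<n}" and vs: "permute_list p ws = vs"
    using mset_eq_permutation n by metis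
  have p0: "p permutes {0..<n}" using p by (simp add: lessThan_atLeast0)
  have ent: "vs ! i = ws ! p i" if "i < n" for i
    using vs that n p by (metis permute_list_nth)
  have less: "p i < n" if "i < n" for i
    using p that by (metis lessThan_iff permutes_in_image)
  have inj: "p i = p j \<longleftrightarrow> i = j" for i j
    using p by (metis permutes_inj injD)
  let ?A = "char_poly_matrix (H_mat_of D ws)"
  let ?B = "mat n n (\<lambda>(i, j). ?A $$ (p i, j))"
  have A: "?A \<in> carrier_mat n n" using n by (simp add: H_mat_of_def)
  have eq: "transpose_mat (char_poly_matrix (H_mat_of D vs))
      = mat n n (\<lambda>(i, j). transpose_mat ?B $$ (p i, j))"
    by (rule eq_matI)
      (auto simp: char_poly_matrix_def H_mat_of_def n n_def[symmetric] ent less inj)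
  have "char_poly (H_mat_of D vs) = det (transpose_mat (char_poly_matrix (H_mat_of D vs)))"
    unfolding char_poly_def
    by (rule det_transpose[symmetric, where n = n]) (simp add: H_mat_of_def n_def)
  also have "\<dots> = signof p * det (transpose_mat ?B)"
    unfolding eq by (rule det_permute_rows[OF _ p0]) simp
  also have "det (transpose_mat ?B) = det ?B"
    by (rule det_transpose[where n = n]) simp
  also have "det ?B = signof p * det ?A"
    by (rule det_permute_rows[OF A p0])
  also have "signof p * (signof p * det ?A) = det ?A"
    by (simp add: sign_def)
  finally show ?thesis by (simp add: char_poly_def)
qed

lemma char_poly_H_mat:
  assumes "distinct vs" "set vs = verts D"
  shows "char_poly (H_mat D) = char_poly (H_mat_of D vs)"
proof -
  have "finite (verts D)" using assms(2) by (metis List.finite_set)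
  then show ?thesis
    unfolding H_mat_def
    by (intro char_poly_H_mat_of_permute) (simp_all add: vertex_list assms)
qed

lemma eigenvalue_H_mat_real:
  assumes "finite (verts D)" "eigenvalue (H_mat D) x"
  shows "x \<in> \<real>"
proof -
  define A n where "A = H_mat D" and "n = card (verts D)"
  have A: "A \<in> carrier_mat n n" using H_mat_carrier[OF assms(1)] by (simp add: A_def n_def)
  have herm: "cnj (A $$ (i, j)) = A $$ (j, i)" if "i < n" "j < n" for i j
    using that assms(1)
    by (simp add: A_def n_def H_mat_def H_mat_of_def vertex_list H_entry_cnj)
  obtain v where v: "v \<in> carrier_vec n" "v \<noteq> 0\<^sub>v n" "A *\<^sub>v v = x \<cdot>\<^sub>v v"
    using assms(2) A unfolding eigenvalue_def eigenvector_def A_def by auto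
  define s where "s = (\<Sum>i<n. (cmod (v $ i))\<^sup>2)"
  define q where "q = (\<Sum>i<n. \<Sum>j<n. cnj (v $ i) * A $$ (i, j) * v $ j)"
  obtain k where k: "k < n" "v $ k \<noteq> 0"
    using v(1,2) by (metis carrier_vecD eq_vecI index_zero_vec)
  have "0 < s"
    unfolding s_def using k by (intro sum_pos2[of _ k]) auto
  have row: "(\<Sum>j<n. A $$ (i, j) * v $ j) = x * v $ i" if "i < n" for i
  proof -
    have "(A *\<^sub>v v) $ i = x * v $ i" using v that by simp
    then show ?thesis
      using A v(1) that by (simp add: scalar_prod_def lessThan_atLeast0)
  qed
  have "q = (\<Sum>i<n. cnj (v $ i) * (\<Sum>j<n. A $$ (i, j) * v $ j))"
    by (simp add: q_def sum_distrib_left mult.assoc)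
  also have "\<dots> = (\<Sum>i<n. cnj (v $ i) * (x * v $ i))"
    using row by (intro sum.cong) auto
  also have "\<dots> = (\<Sum>i<n. x * complex_of_real ((cmod (v $ i))\<^sup>2))"
    by (intro sum.cong refl) (simp only: complex_norm_square, simp add: mult_ac)
  finally have q: "q = x * complex_of_real s"
    by (simp add: s_def sum_distrib_left)
  have "cnj q = (\<Sum>i<n. \<Sum>j<n. cnj (v $ j) * A $$ (j, i) * v $ i)"
    unfolding q_def cnj_sum by (intro sum.cong refl) (simp add: herm mult_ac)
  also have "\<dots> = q" unfolding q_def by (rule sum.swap)
  finally have "cnj x * complex_of_real s = x * complex_of_real s" using q by simp
  then have "cnj x = x" using \<open>0 < s\<close> by simp
  then show ?thesis by (simp add: Reals_cnj_iff)
qed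

lemma mset_H_spectrum:
  assumes "finite (verts D)"
  shows "image_mset complex_of_real (mset (H_spectrum D)) = proots (char_poly (H_mat D))"
proof -
  have "char_poly (H_mat D) \<noteq> 0"
    using degree_monic_char_poly[OF H_mat_carrier[OF assms]] by auto
  then have "complex_of_real (Re x) = x" if "x \<in># proots (char_poly (H_mat D))" for x
    using that eigenvalue_H_mat_real[OF assms]
      eigenvalue_root_char_poly[OF H_mat_carrier[OF assms]] by simp
  then have "image_mset (\<lambda>x. complex_of_real (Re x)) (proots (char_poly (H_mat D)))
      = image_mset (\<lambda>x. x) (proots (char_poly (H_mat D)))"
    by (intro image_mset_cong) auto
  then show ?thesis
    by (simp add: H_spectrum_def image_mset.compositionality comp_def)
qed

lemma length_H_spectrum:
  assumes "finite (verts D)"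
  shows "length (H_spectrum D) = card (verts D)"
proof -
  have "length (H_spectrum D) = size (image_mset complex_of_real (mset (H_spectrum D)))"
    by simp
  also have "\<dots> = card (verts D)"
    unfolding mset_H_spectrum[OF assms] size_proots_complex
    using degree_monic_char_poly[OF H_mat_carrier[OF assms]] by simp
  finally show ?thesis .
qed

end

theory Submission
  imports Defs "HOL-Analysis.Function_Topology"
begin

text \<open>
  By compactness of the unit sphere, the quadratic form of \<open>H(G)\<close> satisfies
  \<open>y\<^sup>T H(G) y \<le> \<lambda>\<^sub>1(G) |y|\<^sup>2\<close> for real \<open>y\<close>, with equality only for eigenvectors. The entries of \<open>H(D)\<close>
  are bounded in modulus by those of \<open>H(G)\<close>, so passing to \<open>y = |f|\<close> for an eigenvector \<open>f\<close> of \<open>D\<close>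
  bounds all eigenvalues of \<open>D\<close> in modulus by \<open>\<lambda>\<^sub>1(G)\<close>. If \<open>-\<lambda>\<^sub>1(G)\<close> is attained, all these estimates
  are equalities: \<open>y\<close> is a nonnegative eigenvector of \<open>G\<close>, hence positive by connectedness, and the
  phases \<open>x = f / |f|\<close> satisfy \<open>H(D)\<^sub>u\<^sub>w = - H(G)\<^sub>u\<^sub>w x\<^sub>u cnj (x\<^sub>w)\<close>. This rules out deleted edges and lets
  \<open>x\<close> change only by factors \<open>-1\<close>, \<open>\<i>\<close>, \<open>-\<i>\<close> along edges, so that its level sets are the four parts.
  Conversely, the four parts define a unitary diagonal matrix conjugating \<open>-H(G)\<close> to \<open>H(D)\<close>.
\<close>

definition quad_form :: "'v set \<Rightarrow> ('v \<Rightarrow> 'v \<Rightarrow> real) \<Rightarrow> ('v \<Rightarrow> real) \<Rightarrow> real" where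
  "quad_form V a x = (\<Sum>u\<in>V. \<Sum>w\<in>V. a u w * x u * x w)"

lemma quad_form_scale: "quad_form V a (\<lambda>u. c * x u) = c\<^sup>2 * quad_form V a x"
  by (simp add: quad_form_def sum_distrib_left power2_eq_square mult_ac)

lemma quad_form_add:
  assumes "\<And>u w. u \<in> V \<Longrightarrow> w \<in> V \<Longrightarrow> a u w = a w u"
  shows "quad_form V a (\<lambda>u. x u + t * y u) =
    quad_form V a x + 2 * t * (\<Sum>u\<in>V. y u * (\<Sum>w\<in>V. a u w * x w)) + t\<^sup>2 * quad_form V a y"
proof -
  have "(\<Sum>u\<in>V. \<Sum>w\<in>V. a u w * x u * y w) = (\<Sum>w\<in>V. \<Sum>u\<in>V. a u w * x u * y w)"
    by (rule sum.swap)
  also have "\<dots> = (\<Sum>u\<in>V. y u * (\<Sum>w\<in>V. a u w * x w))"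
    by (simp add: sum_distrib_left mult_ac assms cong: sum.cong)
  finally have "(\<Sum>u\<in>V. \<Sum>w\<in>V. a u w * x u * y w) = (\<Sum>u\<in>V. y u * (\<Sum>w\<in>V. a u w * x w))" .
  moreover have "(\<Sum>u\<in>V. \<Sum>w\<in>V. a u w * y u * x w) = (\<Sum>u\<in>V. y u * (\<Sum>w\<in>V. a u w * x w))"
    by (simp add: sum_distrib_left mult_ac)
  moreover have "quad_form V a (\<lambda>u. x u + t * y u) =
    quad_form V a x + t * (\<Sum>u\<in>V. \<Sum>w\<in>V. a u w * x u * y w)
    + t * (\<Sum>u\<in>V. \<Sum>w\<in>V. a u w * y u * x w) + t\<^sup>2 * quad_form V a y"
    by (simp add: quad_form_def sum_distrib_left sum.distrib[symmetric] power2_eq_square algebra_simps)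
  ultimately show ?thesis by simp
qed

lemma quad_form_maximizer_eigenvector:
  assumes fin: "finite V"
    and sym: "\<And>u w. u \<in> V \<Longrightarrow> w \<in> V \<Longrightarrow> a u w = a w u"
    and le: "\<And>y. quad_form V a y \<le> \<rho> * (\<Sum>u\<in>V. (y u)\<^sup>2)"
    and eq: "\<rho> * (\<Sum>u\<in>V. (x u)\<^sup>2) \<le> quad_form V a x"
    and u: "u \<in> V"
  shows "(\<Sum>w\<in>V. a u w * x w) = \<rho> * x u"
proof -
  define g where "g u = \<rho> * x u - (\<Sum>w\<in>V. a u w * x w)" for u
  define N where "N = (\<Sum>u\<in>V. (g u)\<^sup>2)"
  define q where "q = \<rho> * N - quad_form V a g"
  have q0: "q \<ge> 0" using le[of g] by (simp add: q_def N_def)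
  have "N = (\<Sum>u\<in>V. g u * (\<rho> * x u)) - (\<Sum>u\<in>V. g u * (\<Sum>w\<in>V. a u w * x w))"
    unfolding N_def sum_subtractf[symmetric]
    by (intro sum.cong refl) (simp add: g_def power2_eq_square algebra_simps)
  then have N: "(\<Sum>u\<in>V. g u * (\<Sum>w\<in>V. a u w * x w)) = \<rho> * (\<Sum>u\<in>V. g u * x u) - N"
    by (simp add: sum_distrib_left mult_ac)
  have nonneg: "0 \<le> 2 * t * N + t\<^sup>2 * q" for t
  proof -
    have "(\<Sum>u\<in>V. (x u + t * g u)\<^sup>2) =
      (\<Sum>u\<in>V. (x u)\<^sup>2) + 2 * t * (\<Sum>u\<in>V. g u * x u) + t\<^sup>2 * N"
      by (simp add: N_def sum_distrib_left sum.distrib[symmetric] power2_eq_square algebra_simps)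
    then have "quad_form V a x + 2 * t * (\<rho> * (\<Sum>u\<in>V. g u * x u) - N) + t\<^sup>2 * quad_form V a g
      \<le> \<rho> * ((\<Sum>u\<in>V. (x u)\<^sup>2) + 2 * t * (\<Sum>u\<in>V. g u * x u) + t\<^sup>2 * N)"
      using le[of "\<lambda>u. x u + t * g u"] quad_form_add[of V a x t g] sym by (simp add: N)
    then show ?thesis using eq by (simp add: q_def algebra_simps)
  qed
  have "N \<le> 0"
  proof (rule ccontr)
    assume "\<not> N \<le> 0"
    then have "N > 0" by simp
    define t where "t = - N / (q + 1)"
    have "t < 0" using \<open>N > 0\<close> q0 by (simp add: t_def)
    have tq: "t * (q + 1) = - N" using q0 by (simp add: t_def)
    have "2 * t * N + t\<^sup>2 * q = t * (2 * N + t * (q + 1) - t)"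
      by (simp add: power2_eq_square algebra_simps)
    also have "\<dots> = t * (N - t)" by (simp add: tq)
    also have "\<dots> < 0" using \<open>t < 0\<close> \<open>N > 0\<close> by (simp add: mult_neg_pos)
    finally show False using nonneg[of t] by simp
  qed
  then have "N = 0" unfolding N_def by (meson dual_order.antisym sum_nonneg zero_le_power2)
  then have "g u = 0" using u fin unfolding N_def by (simp add: sum_nonneg_eq_0_iff)
  then show ?thesis by (simp add: g_def)
qed

lemma quad_form_top_eigenvector:
  assumes fin: "finite V" and ne: "V \<noteq> {}"
    and sym: "\<And>u w. u \<in> V \<Longrightarrow> w \<in> V \<Longrightarrow> a u w = a w u"
  obtains \<rho> x where "\<exists>u\<in>V. x u \<noteq> 0" "\<And>u. u \<in> V \<Longrightarrow> (\<Sum>w\<in>V. a u w * x w) = \<rho> * x u"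
    "\<And>y. quad_form V a y \<le> \<rho> * (\<Sum>u\<in>V. (y u)\<^sup>2)"
proof -
  define B where "B = (PiE UNIV (\<lambda>u. if u \<in> V then {-1..1} else {0::real}))"
  define S where "S = B \<inter> {x. (\<Sum>u\<in>V. (x u)\<^sup>2) = 1}"
  have "compactin (product_topology (\<lambda>i. euclidean) UNIV) B"
    unfolding B_def compactin_PiE by auto
  then have "compact B" by (simp add: euclidean_product_topology)
  moreover have "closed {x :: 'a \<Rightarrow> real. (\<Sum>u\<in>V. (x u)\<^sup>2) = 1}"
    by (auto intro!: closed_Collect_eq continuous_intros)
  ultimately have "compact S" unfolding S_def by (rule compact_Int_closed)
  obtain v where v: "v \<in> V" using ne by auto
  have "(\<lambda>u. if u = v then 1 else 0) \<in> S"
    using v fin by (auto simp: S_def B_def sum.delta if_distrib[of "\<lambda>x. x\<^sup>2"] cong: if_cong)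
  then have "S \<noteq> {}" by blast
  moreover have "continuous_on S (quad_form V a)"
    unfolding quad_form_def by (intro continuous_intros continuous_on_subset[OF continuous_on_product_coordinates]) auto
  ultimately obtain x where x: "x \<in> S" "\<And>y. y \<in> S \<Longrightarrow> quad_form V a y \<le> quad_form V a x"
    using continuous_attains_sup[OF \<open>compact S\<close>] by blast
  define \<rho> where "\<rho> = quad_form V a x"
  have le: "quad_form V a y \<le> \<rho> * (\<Sum>u\<in>V. (y u)\<^sup>2)" for y
  proof (cases "\<forall>u\<in>V. y u = 0")
    case True
    then show ?thesis by (simp add: quad_form_def)
  next
    case False
    define s where "s = (\<Sum>u\<in>V. (y u)\<^sup>2)"
    obtain k where "k \<in> V" "y k \<noteq> 0" using False by blast
    then have "s > 0" unfolding s_def using fin by (intro sum_pos2[of _ k]) auto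
    define z where "z u = (if u \<in> V then 1 / sqrt s * y u else 0)" for u
    have zz: "(\<Sum>u\<in>V. (z u)\<^sup>2) = 1"
    proof -
      have "(\<Sum>u\<in>V. (z u)\<^sup>2) = (\<Sum>u\<in>V. (y u)\<^sup>2 / s)"
        using \<open>s > 0\<close> by (intro sum.cong) (auto simp: z_def power_divide)
      then show ?thesis using \<open>s > 0\<close> by (simp add: sum_divide_distrib[symmetric] s_def)
    qed
    have "- 1 \<le> z u \<and> z u \<le> 1" if "u \<in> V" for u
    proof -
      have "(z u)\<^sup>2 \<le> 1" using member_le_sum[of u V "\<lambda>u. (z u)\<^sup>2"] that fin zz by simp
      then show ?thesis by (simp add: abs_square_le_1 abs_le_iff)
    qed
    moreover have "z u = 0" if "u \<notin> V" for u using that by (simp add: z_def)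
    ultimately have "z \<in> S" using zz by (auto simp: S_def B_def)
    then have "quad_form V a z \<le> \<rho>" unfolding \<rho>_def by (rule x(2))
    moreover have "quad_form V a z = quad_form V a (\<lambda>u. 1 / sqrt s * y u)"
      by (simp add: quad_form_def z_def cong: sum.cong)
    ultimately show ?thesis
      using \<open>s > 0\<close> unfolding quad_form_scale s_def[symmetric] by (simp add: power_divide field_simps)
  qed
  have sx: "(\<Sum>u\<in>V. (x u)\<^sup>2) = 1" using x(1) by (simp add: S_def)
  have "\<exists>u\<in>V. x u \<noteq> 0"
  proof (rule ccontr)
    assume "\<not> ?thesis"
    then show False using sx by simp
  qed
  moreover have "(\<Sum>w\<in>V. a u w * x w) = \<rho> * x u" if "u \<in> V" for u
    by (rule quad_form_maximizer_eigenvector[where a = a, OF fin sym le _ that]) (simp_all add: sx \<rho>_def)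
  ultimately show ?thesis using that le by blast
qed

lemma order_prod_list_uminus:
  "order (- x) (\<Prod>a\<leftarrow>as. [:a, 1:]) = order x (\<Prod>a\<leftarrow>as. [:- a, 1:])" for x :: complex
  by (subst (1 2) order_prod_list) (auto simp: o_def order_linear')

lemma order_char_poly_uminus:
  fixes A :: "complex mat"
  assumes A: "A \<in> carrier_mat n n"
  shows "order (- x) (char_poly (- A)) = order x (char_poly A)"
proof -
  obtain as where as: "char_poly A = (\<Prod>a\<leftarrow>as. [:- a, 1:])" "length as = n"
    using char_poly_factorized[OF A] by blast
  have mA: "- A \<in> carrier_mat n n" using A by simp
  have "poly (char_poly (- A)) t = poly (\<Prod>a\<leftarrow>as. [:a, 1:]) t" for t
  proof -
    have "poly (char_poly (- A)) t = det (- char_matrix (- A) t)"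
      by (rule char_poly_matrix[OF mA])
    also have "- char_matrix (- A) t = (- 1) \<cdot>\<^sub>m (- char_matrix A (- t))"
      using A by (intro eq_matI) (auto simp: char_matrix_def)
    also have "det \<dots> = (- 1) ^ n * poly (char_poly A) (- t)"
      using A by (simp add: char_poly_matrix[OF A] char_matrix_def)
    also have "\<dots> = poly (\<Prod>a\<leftarrow>as. [:a, 1:]) t"
      unfolding as(1) as(2)[symmetric] by (induction as) (auto simp: algebra_simps)
    finally show ?thesis .
  qed
  then have "char_poly (- A) = (\<Prod>a\<leftarrow>as. [:a, 1:])" by (rule poly_ext)
  then show ?thesis by (simp add: as(1) order_prod_list_uminus)
qed

lemma eigenvalue_H_mat_iff:
  assumes fin: "finite (verts D)"
  shows "eigenvalue (H_mat D) x \<longleftrightarrow>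
    (\<exists>f. (\<exists>v\<in>verts D. f v \<noteq> 0) \<and>
      (\<forall>u\<in>verts D. (\<Sum>w\<in>verts D. H_entry D u w * f w) = x * f u))"
proof -
  define vs n where "vs = vertex_list (verts D)" and "n = card (verts D)"
  have vs: "distinct vs" "set vs = verts D" "length vs = n"
    using vertex_list[OF fin] by (simp_all add: vs_def n_def)
  have bij: "bij_betw ((!) vs) {..<n} (verts D)"
    using vs by (intro bij_betw_nth) auto
  have sum: "(\<Sum>w\<in>verts D. h w) = (\<Sum>i<n. h (vs ! i))" for h :: "_ \<Rightarrow> complex"
    by (rule sum.reindex_bij_betw[OF bij, symmetric])
  have ball: "(\<forall>u\<in>verts D. Q u) \<longleftrightarrow> (\<forall>i<n. Q (vs ! i))" for Q
    using vs by (metis in_set_conv_nth nth_mem)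
  have H: "H_mat D \<in> carrier_mat n n" "\<And>i j. i < n \<Longrightarrow> j < n \<Longrightarrow> H_mat D $$ (i, j) = H_entry D (vs ! i) (vs ! j)"
    using H_mat_carrier[OF fin] vs by (simp_all add: n_def H_mat_def H_mat_of_def vs_def)
  have mv: "(H_mat D *\<^sub>v v) $ i = (\<Sum>j<n. H_entry D (vs ! i) (vs ! j) * v $ j)"
    if "v \<in> carrier_vec n" "i < n" for v i
    using H that by (auto simp: scalar_prod_def lessThan_atLeast0 intro!: sum.cong)
  have iff: "eigenvector (H_mat D) v x \<longleftrightarrow> v \<in> carrier_vec n \<and> (\<exists>i<n. v $ i \<noteq> 0) \<and>
      (\<forall>i<n. (\<Sum>j<n. H_entry D (vs ! i) (vs ! j) * v $ j) = x * v $ i)" for v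
  proof (cases "v \<in> carrier_vec n")
    case True
    then have "v \<noteq> 0\<^sub>v n \<longleftrightarrow> (\<exists>i<n. v $ i \<noteq> 0)"
      by (metis carrier_vecD eq_vecI index_zero_vec)
    moreover have "H_mat D *\<^sub>v v = x \<cdot>\<^sub>v v \<longleftrightarrow> (\<forall>i<n. (H_mat D *\<^sub>v v) $ i = x * v $ i)"
      using True H(1) by (auto simp del: index_mult_mat_vec intro!: eq_vecI)
    ultimately show ?thesis
      using True H(1) mv[OF True] by (auto simp: eigenvector_def)
  qed (use H(1) in \<open>auto simp: eigenvector_def\<close>)
  show ?thesis
  proof
    assume "eigenvalue (H_mat D) x"
    then obtain v where v: "(\<exists>i<n. v $ i \<noteq> 0)"
      "\<forall>i<n. (\<Sum>j<n. H_entry D (vs ! i) (vs ! j) * v $ j) = x * v $ i"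
      unfolding eigenvalue_def iff by blast
    define f where "f u = v $ the_inv_into {..<n} ((!) vs) u" for u
    have f: "f (vs ! i) = v $ i" if "i < n" for i
      using that bij by (simp add: f_def bij_betw_def the_inv_into_f_f)
    have "\<exists>v\<in>verts D. f v \<noteq> 0" using v(1) f vs by (metis nth_mem)
    moreover have "\<forall>u\<in>verts D. (\<Sum>w\<in>verts D. H_entry D u w * f w) = x * f u"
      using v(2) by (simp add: ball sum f)
    ultimately show "\<exists>f. (\<exists>v\<in>verts D. f v \<noteq> 0) \<and>
      (\<forall>u\<in>verts D. (\<Sum>w\<in>verts D. H_entry D u w * f w) = x * f u)" by blast
  next
    assume "\<exists>f. (\<exists>v\<in>verts D. f v \<noteq> 0) \<and>
      (\<forall>u\<in>verts D. (\<Sum>w\<in>verts D. H_entry D u w * f w) = x * f u)"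
    then obtain f where f: "\<exists>v\<in>verts D. f v \<noteq> 0"
      "\<forall>u\<in>verts D. (\<Sum>w\<in>verts D. H_entry D u w * f w) = x * f u" by blast
    have "\<exists>i<n. f (vs ! i) \<noteq> 0" using f(1) vs by (metis in_set_conv_nth)
    then have "eigenvector (H_mat D) (vec n (\<lambda>i. f (vs ! i))) x"
      unfolding iff using f(2) by (auto simp: ball sum)
    then show "eigenvalue (H_mat D) x" unfolding eigenvalue_def by blast
  qed
qed

lemma set_H_spectrum:
  assumes fin: "finite (verts D)"
  shows "l \<in> set (H_spectrum D) \<longleftrightarrow> eigenvalue (H_mat D) (complex_of_real l)"
proof -
  have "char_poly (H_mat D) \<noteq> 0"
    using degree_monic_char_poly[OF H_mat_carrier[OF fin]] by auto
  then have "eigenvalue (H_mat D) (complex_of_real l) \<longleftrightarrow>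
      complex_of_real l \<in># image_mset complex_of_real (mset (H_spectrum D))"
    unfolding mset_H_spectrum[OF fin] eigenvalue_root_char_poly[OF H_mat_carrier[OF fin]] by simp
  then show ?thesis by auto
qed

lemma sorted_rev_H_spectrum: "sorted (rev (H_spectrum D))"
  by (simp add: H_spectrum_def)

lemma H_eigenvalue_is_eigenvalue:
  assumes "finite (verts D)" "1 \<le> k" "k \<le> card (verts D)"
  shows "eigenvalue (H_mat D) (complex_of_real (H_eigenvalue k D))"
  unfolding set_H_spectrum[OF assms(1), symmetric] H_eigenvalue_def
  using assms by (intro nth_mem) (simp add: length_H_spectrum)

lemma eigenvalue_between:
  assumes fin: "finite (verts D)" and ev: "eigenvalue (H_mat D) (complex_of_real l)"
  shows "l \<le> H_eigenvalue 1 D" "H_eigenvalue (card (verts D)) D \<le> l"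
proof -
  obtain i where i: "i < card (verts D)" "l = H_spectrum D ! i"
    using ev unfolding set_H_spectrum[OF fin, symmetric] in_set_conv_nth length_H_spectrum[OF fin]
    by blast
  then show "l \<le> H_eigenvalue 1 D" "H_eigenvalue (card (verts D)) D \<le> l"
    using sorted_rev_nth_mono[OF sorted_rev_H_spectrum[of D]]
    by (simp_all add: H_eigenvalue_def length_H_spectrum[OF fin])
qed

lemma count_edges_underlying:
  "count (edges (underlying D)) (Upair u v) =
    count (edges D) (Upair u v) + (if u = v then count (arcs D) (u, u)
      else count (arcs D) (u, v) + count (arcs D) (v, u))"
proof -
  have "count (image_mset (\<lambda>(x, y). Upair x y) A) (Upair u v) =
    (if u = v then count A (u, u) else count A (u, v) + count A (v, u))" for A :: "('a \<times> 'a) multiset"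
  proof (induction A)
    case (add p A)
    obtain x y where p: "p = (x, y)" by (cases p)
    have "Upair x y = Upair u v \<longleftrightarrow> (x = u \<and> y = v) \<or> (x = v \<and> y = u)"
      by (simp only: Upair_inject)
    then show ?case
      using add by (cases "u = v") (simp_all only: p image_mset_add_mset count_add_mset prod.case prod.inject, auto)
  qed simp
  then show ?thesis by (simp add: underlying_def)
qed

lemma count_arcs_le:
  assumes "delete_orient G D"
  shows "count (edges D) (Upair u v) + count (arcs D) (u, v) + count (arcs D) (v, u)
    \<le> count (edges G) (Upair u v)"
proof -
  have "count (arcs D) (u, u) = 0"
    using assms by (auto simp: delete_orient_def mixed_multigraph_def count_eq_zero_iff)
  then have "count (edges D) (Upair u v) + count (arcs D) (u, v) + count (arcs D) (v, u)
      = count (edges (underlying D)) (Upair u v)"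
    unfolding count_edges_underlying by auto
  also have "\<dots> \<le> count (edges G) (Upair u v)"
    using assms by (intro mset_subset_eq_count) (simp add: delete_orient_def)
  finally show ?thesis .
qed

lemma norm_H_entry_le:
  assumes "delete_orient G D"
  shows "cmod (H_entry D u v) \<le> real (count (edges G) (Upair u v))"
proof -
  define z where "z = complex_of_real (real (count (edges D) (Upair u v)))"
  define y where "y = \<i> * complex_of_real (real (count (arcs D) (u, v)))"
  define x where "x = \<i> * complex_of_real (real (count (arcs D) (v, u)))"
  have "cmod (z + y - x) \<le> cmod z + cmod y + cmod x"
    by (rule order_trans[OF norm_triangle_ineq4]) (simp add: norm_triangle_ineq)
  then have "cmod (H_entry D u v) \<le> real (count (edges D) (Upair u v))
      + real (count (arcs D) (u, v)) + real (count (arcs D) (v, u))"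
    by (simp add: H_entry_def x_def y_def z_def norm_mult)
  also have "\<dots> \<le> real (count (edges G) (Upair u v))"
    using count_arcs_le[OF assms, of u v] by linarith
  finally show ?thesis .
qed

lemma count_edges_commute: "count (edges G) (Upair u w) = count (edges G) (Upair w u)"
proof -
  have "Upair u w = Upair w u" by (simp only: Upair_inject) simp
  then show ?thesis by (rule arg_cong)
qed

lemma H_entry_undirected:
  assumes "undirected_multigraph G"
  shows "H_entry G u v = complex_of_real (real (count (edges G) (Upair u v)))"
  using assms by (simp add: H_entry_def undirected_multigraph_def)

lemma quad_form_le_H_eigenvalue_1:
  assumes G: "undirected_multigraph G" and ne: "verts G \<noteq> {}"
  shows "quad_form (verts G) (\<lambda>u w. real (count (edges G) (Upair u w))) y
    \<le> H_eigenvalue 1 G * (\<Sum>u\<in>verts G. (y u)\<^sup>2)"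
proof -
  define a where "a u w = real (count (edges G) (Upair u w))" for u w
  have fin: "finite (verts G)"
    using G by (simp add: undirected_multigraph_def mixed_multigraph_def)
  have sym: "a u w = a w u" for u w
    unfolding a_def by (rule arg_cong[OF count_edges_commute])
  obtain \<rho> x where x: "\<exists>u\<in>verts G. x u \<noteq> 0"
      "\<And>u. u \<in> verts G \<Longrightarrow> (\<Sum>w\<in>verts G. a u w * x w) = \<rho> * x u"
    and le: "\<And>y. quad_form (verts G) a y \<le> \<rho> * (\<Sum>u\<in>verts G. (y u)\<^sup>2)"
    by (rule quad_form_top_eigenvector[where a = a, OF fin ne sym]) auto
  have "(\<Sum>w\<in>verts G. H_entry G u w * complex_of_real (x w)) = complex_of_real \<rho> * complex_of_real (x u)"
    if "u \<in> verts G" for u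
  proof -
    have "(\<Sum>w\<in>verts G. H_entry G u w * complex_of_real (x w)) =
        complex_of_real (\<Sum>w\<in>verts G. a u w * x w)"
      by (simp add: H_entry_undirected[OF G] a_def)
    then show ?thesis by (simp add: x(2)[OF that])
  qed
  then have "eigenvalue (H_mat G) (complex_of_real \<rho>)"
    unfolding eigenvalue_H_mat_iff[OF fin]
    by (intro exI[of _ "\<lambda>u. complex_of_real (x u)"]) (use x(1) in simp)
  then have "\<rho> \<le> H_eigenvalue 1 G" by (rule eigenvalue_between[OF fin])
  then show ?thesis
    using le[of y] unfolding a_def
    by (elim order_trans) (intro mult_right_mono sum_nonneg zero_le_power2)
qed

lemma eigenvalue_H_mat_quotient:
  assumes "\<And>u. u \<in> V \<Longrightarrow> (\<Sum>w\<in>V. H_entry D u w * f w) = complex_of_real \<mu> * f u"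
  shows "(\<Sum>u\<in>V. \<Sum>w\<in>V. cnj (f u) * H_entry D u w * f w)
    = complex_of_real (\<mu> * (\<Sum>u\<in>V. (cmod (f u))\<^sup>2))"
proof -
  have "(\<Sum>u\<in>V. \<Sum>w\<in>V. cnj (f u) * H_entry D u w * f w) = (\<Sum>u\<in>V. cnj (f u) * (complex_of_real \<mu> * f u))"
    by (intro sum.cong refl) (simp add: assms[symmetric] sum_distrib_left mult.assoc)
  also have "\<dots> = (\<Sum>u\<in>V. complex_of_real \<mu> * complex_of_real ((cmod (f u))\<^sup>2))"
    by (intro sum.cong refl) (simp only: complex_norm_square, simp add: mult_ac)
  finally show ?thesis by (simp add: sum_distrib_left)
qed

lemma norm_H_term_le:
  assumes "delete_orient G D"
  shows "cmod (cnj (f u) * H_entry D u w * f w)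
    \<le> real (count (edges G) (Upair u w)) * cmod (f u) * cmod (f w)"
proof -
  have "cmod (cnj (f u) * H_entry D u w * f w) = cmod (H_entry D u w) * (cmod (f u) * cmod (f w))"
    by (simp add: norm_mult)
  also have "\<dots> \<le> real (count (edges G) (Upair u w)) * (cmod (f u) * cmod (f w))"
    by (intro mult_right_mono norm_H_entry_le[OF assms]) simp
  finally show ?thesis by (simp add: mult.assoc)
qed

lemma abs_eigenvalue_le_H_eigenvalue_1:
  assumes G: "undirected_multigraph G" and D: "delete_orient G D"
    and ev: "eigenvalue (H_mat D) (complex_of_real \<mu>)"
  shows "\<bar>\<mu>\<bar> \<le> H_eigenvalue 1 G"
proof -
  have V: "verts D = verts G" and fin: "finite (verts D)"
    using D unfolding delete_orient_def mixed_multigraph_def by blast+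
  obtain f where f: "\<exists>v\<in>verts D. f v \<noteq> 0"
    "\<And>u. u \<in> verts D \<Longrightarrow> (\<Sum>w\<in>verts D. H_entry D u w * f w) = complex_of_real \<mu> * f u"
    using ev unfolding eigenvalue_H_mat_iff[OF fin] by blast
  define s where "s = (\<Sum>u\<in>verts D. (cmod (f u))\<^sup>2)"
  have "s > 0" using f(1) fin unfolding s_def by (auto intro: sum_pos2)
  have "\<bar>\<mu>\<bar> * s = cmod (\<Sum>u\<in>verts D. \<Sum>w\<in>verts D. cnj (f u) * H_entry D u w * f w)"
    using \<open>s > 0\<close> eigenvalue_H_mat_quotient[OF f(2)] by (simp add: s_def[symmetric] abs_mult norm_mult)
  also have "\<dots> \<le> (\<Sum>u\<in>verts D. \<Sum>w\<in>verts D. real (count (edges G) (Upair u w)) * cmod (f u) * cmod (f w))"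
    by (intro sum_norm_le norm_H_term_le D)
  also have "\<dots> = quad_form (verts G) (\<lambda>u w. real (count (edges G) (Upair u w))) (\<lambda>u. cmod (f u))"
    by (simp add: quad_form_def V)
  also have "\<dots> \<le> H_eigenvalue 1 G * s"
    unfolding s_def V by (rule quad_form_le_H_eigenvalue_1[OF G]) (use f(1) V in auto)
  finally show ?thesis using \<open>s > 0\<close> by simp
qed

lemma connected_multigraph_induct [consumes 5, case_names step]:
  assumes "undirected_multigraph G" "connected_multigraph G" "v \<in> verts G"
    and "r \<in> verts G" "Q r"
    and step: "\<And>u w. u \<in> verts G \<Longrightarrow> w \<in> verts G \<Longrightarrow> Upair u w \<in># edges G \<Longrightarrow> Q u \<Longrightarrow> Q w"
  shows "Q v"
proof -
  have "edges (underlying G) = edges G"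
    using assms(1) by (simp add: underlying_def undirected_multigraph_def)
  then have "(r, v) \<in> {(x, y). Upair x y \<in># edges G}\<^sup>*"
    using assms(2-4) by (simp add: connected_multigraph_def)
  then have "v \<in> verts G \<and> Q v"
  proof (induction rule: rtrancl_induct)
    case (step u w)
    then have e: "Upair u w \<in># edges G" by simp
    then have "set_uprod (Upair u w) \<subseteq> verts G"
      using assms(1) unfolding undirected_multigraph_def mixed_multigraph_def by blast
    then have "w \<in> verts G" by simp
    then show ?case using step.IH e assms(6) by blast
  qed (use assms in simp)
  then show ?thesis ..
qed

lemma cmod_le_minus_Re:
  assumes "cmod z \<le> c" "Re z = - c"
  shows "z = - complex_of_real c"
proof -
  have "c \<ge> 0" using assms(1) norm_ge_zero order_trans by blast
  then have "(cmod z)\<^sup>2 \<le> c\<^sup>2" using assms(1) by (simp add: power_mono)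
  then have "Im z = 0" using assms(2) by (simp add: cmod_power2)
  then show ?thesis using assms(2) by (simp add: complex_eq_iff)
qed

lemma extremal_eigenvalue_phases:
  assumes G: "undirected_multigraph G" and conn: "connected_multigraph G" and D: "delete_orient G D"
    and ev: "eigenvalue (H_mat D) (complex_of_real (- H_eigenvalue 1 G))"
  obtains x r where "r \<in> verts G" "x r = 1" "\<And>v. v \<in> verts G \<Longrightarrow> cmod (x v) = 1"
    "\<And>u w. u \<in> verts G \<Longrightarrow> w \<in> verts G \<Longrightarrow>
      H_entry D u w = - (of_nat (count (edges G) (Upair u w)) * (x u * cnj (x w)))"
proof -
  define V where "V = verts G"
  define \<rho> where "\<rho> = H_eigenvalue 1 G"
  define a where "a u w = real (count (edges G) (Upair u w))" for u w
  have VD: "verts D = V" and fin: "finite V"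
    using G D unfolding delete_orient_def undirected_multigraph_def mixed_multigraph_def V_def by blast+
  have sym: "a u w = a w u" for u w
    unfolding a_def by (rule arg_cong[OF count_edges_commute])
  obtain f where f: "\<exists>v\<in>V. f v \<noteq> 0"
    "\<And>u. u \<in> V \<Longrightarrow> (\<Sum>w\<in>V. H_entry D u w * f w) = complex_of_real (- \<rho>) * f u"
    using ev fin unfolding eigenvalue_H_mat_iff[OF fin[folded VD]] VD \<rho>_def by blast
  define y where "y u = cmod (f u)" for u
  have le: "quad_form V a z \<le> \<rho> * (\<Sum>u\<in>V. (z u)\<^sup>2)" for z
    using quad_form_le_H_eigenvalue_1[OF G] f(1) unfolding V_def \<rho>_def a_def by blast
  define t where "t u w = cnj (f u) * H_entry D u w * f w" for u w
  have t_le: "cmod (t u w) \<le> a u w * y u * y w" for u w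
    unfolding t_def a_def y_def by (rule norm_H_term_le[OF D])
  then have Re_le: "- Re (t u w) \<le> a u w * y u * y w" for u w
    using complex_Re_le_cmod[of "- t u w"] by (simp) (meson order_trans)
  have "(\<Sum>u\<in>V. \<Sum>w\<in>V. t u w) = complex_of_real (- \<rho> * (\<Sum>u\<in>V. (y u)\<^sup>2))"
    unfolding t_def y_def by (rule eigenvalue_H_mat_quotient[OF f(2)])
  then have "Re (\<Sum>u\<in>V. \<Sum>w\<in>V. t u w) = - \<rho> * (\<Sum>u\<in>V. (y u)\<^sup>2)" by simp
  then have Re_sum: "(\<Sum>u\<in>V. \<Sum>w\<in>V. - Re (t u w)) = \<rho> * (\<Sum>u\<in>V. (y u)\<^sup>2)"
    by (simp add: sum_negf)
  have qf: "quad_form V a y = (\<Sum>u\<in>V. \<Sum>w\<in>V. a u w * y u * y w)"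
    by (simp add: quad_form_def)
  have ge: "\<rho> * (\<Sum>u\<in>V. (y u)\<^sup>2) \<le> quad_form V a y"
    unfolding Re_sum[symmetric] qf by (intro sum_mono Re_le)
  have zero: "(\<Sum>u\<in>V. \<Sum>w\<in>V. a u w * y u * y w + Re (t u w)) = 0"
    using le[of y] ge Re_sum unfolding qf by (simp add: sum.distrib sum_negf)
  have nonneg: "0 \<le> a u w * y u * y w + Re (t u w)" for u w using Re_le[of u w] by simp
  have Re_eq: "Re (t u w) = - (a u w * y u * y w)" if "u \<in> V" "w \<in> V" for u w
  proof -
    have "(\<Sum>w\<in>V. a u w * y u * y w + Re (t u w)) = 0"
      using zero that(1) nonneg by (subst (asm) sum_nonneg_eq_0_iff[OF fin]) (auto intro: sum_nonneg)
    then have "a u w * y u * y w + Re (t u w) = 0"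
      using that(2) nonneg by (subst (asm) sum_nonneg_eq_0_iff[OF fin]) auto
    then show ?thesis by simp
  qed
  have t_eq: "t u w = - complex_of_real (a u w * y u * y w)" if "u \<in> V" "w \<in> V" for u w
    by (rule cmod_le_minus_Re[OF t_le Re_eq[OF that]])
  have eig: "(\<Sum>w\<in>V. a u w * y w) = \<rho> * y u" if "u \<in> V" for u
    by (rule quad_form_maximizer_eigenvector[where a = a, OF fin sym le ge that])
  have y0: "y u \<noteq> 0" if u: "u \<in> V" for u
  proof
    assume "y u = 0"
    have "y v = 0" if "v \<in> V" for v
      using G conn that[unfolded V_def] u[unfolded V_def] \<open>y u = 0\<close>
    proof (induction rule: connected_multigraph_induct)
      case (step u w)
      have "(\<Sum>w\<in>V. a u w * y w) = 0" using eig[of u] step by (simp add: V_def)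
      then have "a u w * y w = 0"
        using step(2) by (subst (asm) sum_nonneg_eq_0_iff[OF fin]) (auto simp: a_def y_def V_def)
      moreover have "a u w \<noteq> 0"
        using step(3) unfolding a_def of_nat_eq_0_iff count_eq_zero_iff by blast
      ultimately show ?case by simp
    qed
    then show False using f(1) by (simp add: y_def)
  qed
  define x0 where "x0 u = f u / complex_of_real (y u)" for u
  have x0: "cmod (x0 u) = 1" "f u = x0 u * complex_of_real (y u)" if "u \<in> V" for u
    using y0[OF that] by (simp_all add: x0_def norm_divide y_def)
  have x0_cnj: "x0 u * cnj (x0 u) = 1" if "u \<in> V" for u
    using x0(1)[OF that] by (simp add: complex_norm_square[symmetric])
  have H: "H_entry D u w = - (complex_of_real (a u w) * (x0 u * cnj (x0 w)))"
    if u: "u \<in> V" and w: "w \<in> V" for u w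
  proof -
    have "(cnj (x0 u) * H_entry D u w * x0 w) * complex_of_real (y u * y w)
        = - complex_of_real (a u w) * complex_of_real (y u * y w)"
      using t_eq[OF u w] unfolding t_def x0(2)[OF u] x0(2)[OF w] by (simp add: mult_ac)
    moreover have "complex_of_real (y u * y w) \<noteq> 0" using y0 u w by simp
    ultimately have eq: "cnj (x0 u) * H_entry D u w * x0 w = - complex_of_real (a u w)"
      using mult_right_cancel by blast
    have "(x0 u * cnj (x0 u)) * H_entry D u w * (x0 w * cnj (x0 w))
        = x0 u * (cnj (x0 u) * H_entry D u w * x0 w) * cnj (x0 w)"
      by (simp only: mult_ac)
    also have "\<dots> = - (complex_of_real (a u w) * (x0 u * cnj (x0 w)))"
      unfolding eq by (simp add: mult_ac)
    finally have "(x0 u * cnj (x0 u)) * H_entry D u w * (x0 w * cnj (x0 w))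
        = - (complex_of_real (a u w) * (x0 u * cnj (x0 w)))" .
    then show ?thesis by (simp add: x0_cnj u w)
  qed
  obtain r where r: "r \<in> V" using f(1) by blast
  show ?thesis
  proof (rule that[of r "\<lambda>u. x0 u * cnj (x0 r)"])
    show "H_entry D u w = - (of_nat (count (edges G) (Upair u w)) *
        (x0 u * cnj (x0 r) * cnj (x0 w * cnj (x0 r))))"
      if "u \<in> verts G" "w \<in> verts G" for u w
    proof -
      have "x0 u * cnj (x0 r) * cnj (x0 w * cnj (x0 r)) = (x0 r * cnj (x0 r)) * (x0 u * cnj (x0 w))"
        by simp
      then show ?thesis
        using H[of u w] that x0_cnj[OF r] by (simp add: V_def a_def)
    qed
  qed (use r x0 x0_cnj in \<open>auto simp: V_def norm_mult\<close>)
qed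

text \<open>
  The moduli force \<open>e\<^sup>2 + (a - b)\<^sup>2 = g\<^sup>2 \<ge> (e + a + b)\<^sup>2\<close>, so that at most one of \<open>e\<close>, \<open>a\<close>, \<open>b\<close>
  is nonzero.
\<close>

lemma gaussian_entry_cases:
  fixes e a b g :: nat and \<omega> :: complex
  assumes le: "e + a + b \<le> g" and ab: "a = 0 \<or> b = 0"
    and eq: "of_nat e + \<i> * of_nat a - \<i> * of_nat b = - (of_nat g * \<omega>)" and \<omega>: "cmod \<omega> = 1"
  shows "e + a + b = g"
    and "g = 0 \<or> \<omega> = - 1 \<and> a = 0 \<and> b = 0 \<or> \<omega> = - \<i> \<and> e = 0 \<and> b = 0 \<or> \<omega> = \<i> \<and> e = 0 \<and> a = 0"
proof -
  have eq0: "of_nat e + \<i> * of_nat a - \<i> * of_nat b + of_nat g * \<omega> = 0"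
    by (simp add: eq)
  have "cmod (of_nat e + \<i> * of_nat a - \<i> * of_nat b) = real g"
    unfolding eq by (simp add: norm_mult \<omega>)
  then have "(real g)\<^sup>2 = (real e)\<^sup>2 + (real a - real b)\<^sup>2"
    using cmod_power2[of "of_nat e + \<i> * of_nat a - \<i> * of_nat b"] by simp
  also have "\<dots> = (real e)\<^sup>2 + (real a)\<^sup>2 + (real b)\<^sup>2"
    using ab by auto
  finally have "real (g\<^sup>2) = real (e\<^sup>2 + a\<^sup>2 + b\<^sup>2)" by simp
  then have g2: "g\<^sup>2 = e\<^sup>2 + a\<^sup>2 + b\<^sup>2" by (simp only: of_nat_eq_iff)
  have "(e + a + b)\<^sup>2 \<le> g\<^sup>2" using le by (simp add: power_mono)
  then have "e * a = 0" "e * b = 0"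
    unfolding g2 by (simp_all add: power2_eq_square algebra_simps)
  then consider "a = 0" "b = 0" | "e = 0" "b = 0" | "e = 0" "a = 0" using ab by auto
  then have "e + a + b = g \<and> (g = 0 \<or> \<omega> = - 1 \<and> a = 0 \<and> b = 0 \<or> \<omega> = - \<i> \<and> e = 0 \<and> b = 0 \<or> \<omega> = \<i> \<and> e = 0 \<and> a = 0)"
  proof cases
    case 1
    then have "e = g" using g2 by simp
    then have "of_nat g * (\<omega> + 1) = 0" using eq0 1 by (simp add: algebra_simps)
    then show ?thesis using 1 \<open>e = g\<close> by (auto simp: add_eq_0_iff2)
  next
    case 2
    then have "a = g" using g2 by simp
    then have "of_nat g * (\<omega> + \<i>) = 0" using eq0 2 by (simp add: algebra_simps)
    then show ?thesis using 2 \<open>a = g\<close> by (auto simp: add_eq_0_iff2)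
  next
    case 3
    then have "b = g" using g2 by simp
    then have "of_nat g * (\<omega> - \<i>) = 0" using eq0 3 by (simp add: algebra_simps)
    then show ?thesis using 3 \<open>b = g\<close> by auto
  qed
  then show "e + a + b = g"
    and "g = 0 \<or> \<omega> = - 1 \<and> a = 0 \<and> b = 0 \<or> \<omega> = - \<i> \<and> e = 0 \<and> b = 0 \<or> \<omega> = \<i> \<and> e = 0 \<and> a = 0"
    by blast+
qed

lemma imaginary_unit_mult_neq_uminus: "z \<noteq> 0 \<Longrightarrow> \<i> * z \<noteq> - z"
proof
  assume "z \<noteq> 0" "\<i> * z = - z"
  then have "(\<i> + 1) * z = 0" by (simp add: distrib_right)
  then show False using \<open>z \<noteq> 0\<close> by (simp add: complex_eq_iff)
qed

lemma opposite_phases: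
  assumes P: "\<And>j v. j \<in> units4 \<Longrightarrow> v \<in> P j \<Longrightarrow> x v = j"
    and "opposite P u v"
  shows "x v = - x u"
proof -
  obtain j where j: "j \<in> units4" "u \<in> P j" "v \<in> P (- j)"
    using assms(2) by (auto simp: opposite_def)
  moreover have "- j \<in> units4" using j(1) by (auto simp: units4_def)
  ultimately show ?thesis using P by auto
qed

lemma extremal_eigenvalue_four_partition:
  assumes G: "undirected_multigraph G" and conn: "connected_multigraph G" and D: "delete_orient G D"
    and ev: "eigenvalue (H_mat D) (complex_of_real (- H_eigenvalue 1 G))"
  shows "underlying D = G" "\<exists>P. four_partition G D P"
proof -
  obtain x r where r: "r \<in> verts G" "x r = 1" and x1: "\<And>v. v \<in> verts G \<Longrightarrow> cmod (x v) = 1"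
    and H: "\<And>u w. u \<in> verts G \<Longrightarrow> w \<in> verts G \<Longrightarrow>
      H_entry D u w = - (of_nat (count (edges G) (Upair u w)) * (x u * cnj (x w)))"
    using extremal_eigenvalue_phases[OF G conn D ev] by metis
  define g where "g u w = count (edges G) (Upair u w)" for u w
  define e where "e u w = count (edges D) (Upair u w)" for u w
  define a where "a u w = count (arcs D) (u, w)" for u w
  have VD: "verts D = verts G" and mixed: "mixed_multigraph D"
    using D by (simp_all add: delete_orient_def)
  have loops: "a u u = 0" for u
    using mixed by (auto simp: a_def mixed_multigraph_def count_eq_zero_iff)
  have digon: "a u w = 0 \<or> a w u = 0" for u w
    using mixed by (auto simp: a_def mixed_multigraph_def count_eq_zero_iff)
  have G_verts: "u \<in> verts G \<and> w \<in> verts G" if "g u w \<noteq> 0" for u w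
  proof -
    have "Upair u w \<in># edges G" using that by (metis g_def count_eq_zero_iff)
    then have "set_uprod (Upair u w) \<subseteq> verts G"
      using G unfolding undirected_multigraph_def mixed_multigraph_def by blast
    then show ?thesis by simp
  qed
  have le: "e u w + a u w + a w u \<le> g u w" for u w
    unfolding e_def a_def g_def by (rule count_arcs_le[OF D])
  have cases: "e u w + a u w + a w u = g u w"
    "g u w = 0 \<or> x u * cnj (x w) = - 1 \<and> a u w = 0 \<and> a w u = 0
      \<or> x u * cnj (x w) = - \<i> \<and> e u w = 0 \<and> a w u = 0
      \<or> x u * cnj (x w) = \<i> \<and> e u w = 0 \<and> a u w = 0" if "u \<in> verts G" "w \<in> verts G" for u w
    using gaussian_entry_cases[OF le digon, of u w "x u * cnj (x w)"] H[OF that] x1 that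
    by (simp_all add: H_entry_def e_def a_def g_def norm_mult)
  have sum_g: "e u w + a u w + a w u = g u w" for u w
    using cases(1)[of u w] G_verts[of u w] le[of u w] by (cases "g u w = 0") auto
  have move: "x w = cnj \<omega> * x u" if "x u * cnj (x w) = \<omega>" "u \<in> verts G" "w \<in> verts G" for u w \<omega>
  proof -
    have "cnj \<omega> * x u = (x u * cnj (x u)) * x w" unfolding that(1)[symmetric] by simp
    also have "x u * cnj (x u) = 1" using x1[OF that(2)] by (simp add: complex_norm_square[symmetric])
    finally show ?thesis by simp
  qed
  have adj: "x w = - x u \<and> a u w = 0 \<and> a w u = 0
      \<or> x w = \<i> * x u \<and> e u w = 0 \<and> a w u = 0
      \<or> x w = - \<i> * x u \<and> e u w = 0 \<and> a u w = 0" if "g u w \<noteq> 0" for u w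
  proof -
    have V: "u \<in> verts G" "w \<in> verts G" using G_verts[OF that] by simp_all
    from cases(2)[OF V] that consider
        "x u * cnj (x w) = - 1" "a u w = 0" "a w u = 0"
      | "x u * cnj (x w) = - \<i>" "e u w = 0" "a w u = 0"
      | "x u * cnj (x w) = \<i>" "e u w = 0" "a u w = 0"
      by metis
    then show ?thesis
    proof cases
      case 1
      then show ?thesis using move[OF 1(1) V] by simp
    next
      case 2
      then show ?thesis using move[OF 2(1) V] by simp
    next
      case 3
      then show ?thesis using move[OF 3(1) V] by simp
    qed
  qed
  have x0: "x u \<noteq> 0" if "u \<in> verts G" for u using x1[OF that] by auto
  have xr: "x r \<in> units4" by (simp add: r units4_def)
  have units: "x v \<in> units4" if "v \<in> verts G" for v
    using G conn that r(1) xr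
  proof (induction rule: connected_multigraph_induct)
    case (step u w)
    then have "g u w \<noteq> 0" by (simp only: g_def count_eq_zero_iff not_not)
    then show ?case using adj[of u w] step(4) by (auto simp: units4_def)
  qed
  define P where "P j = {v \<in> verts G. x v = j}" for j
  have opp: "x w = - x u" if "opposite P u w" for u w
    by (rule opposite_phases[OF _ that]) (simp add: P_def)
  have nopp: "\<i> * x u \<noteq> - x u" if "u \<in> verts G" for u
    by (rule imaginary_unit_mult_neq_uminus[OF x0[OF that]])
  have arc: "x w = \<i> * x u \<and> u \<in> verts G \<and> w \<in> verts G" if "(u, w) \<in># arcs D" for u w
  proof -
    have "a u w \<noteq> 0" using that by (simp add: a_def)
    then show ?thesis using adj[of u w] le[of u w] G_verts[of u w] by auto
  qed
  have edge: "x w = - x u \<and> u \<in> verts G \<and> w \<in> verts G" if "Upair u w \<in># edges D" for u w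
  proof -
    have "e u w \<noteq> 0" using that by (simp only: e_def count_eq_zero_iff not_not)
    then show ?thesis using adj[of u w] le[of u w] G_verts[of u w] by auto
  qed
  have "four_partition G D P"
    unfolding four_partition_def
  proof (intro conjI)
    show "(\<Union>j\<in>units4. P j) = verts D" using units by (auto simp: P_def VD)
    show "disjoint_family_on P units4" by (auto simp: disjoint_family_on_def P_def)
    show "\<forall>j\<in>units4. \<forall>u\<in>P j. \<forall>v\<in>P j. Upair u v \<notin># edges G"
    proof (intro ballI notI)
      fix j u v assume j: "u \<in> P j" "v \<in> P j" "Upair u v \<in># edges G"
      then have "g u v \<noteq> 0" by (simp only: g_def count_eq_zero_iff not_not)
      then have "x u = - x u \<or> x u = \<i> * x u \<or> x u = - \<i> * x u"
        using adj[of u v] j(1,2) unfolding P_def by fastforce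
      then have "x u = 0" by (auto simp: complex_eq_iff)
      then show False using x0[of u] j(1) by (simp add: P_def)
    qed
    show "\<forall>(u, v)\<in>#arcs D. \<not> opposite P u v"
    proof (intro ballI case_prodI2 notI)
      fix p u v assume "p \<in># arcs D" "p = (u, v)" "opposite P u v"
      then show False using arc[of u v] opp[of u v] nopp[of u] by simp
    qed
    show "\<forall>u v. Upair u v \<in># edges D \<longrightarrow> opposite P u v"
    proof (intro allI impI)
      fix u v assume "Upair u v \<in># edges D"
      then show "opposite P u v"
        using edge[of u v] units[of u] unfolding opposite_def P_def
        by (intro bexI[of _ "x u"]) blast+
    qed
    show "\<forall>(u, v)\<in>#arcs D. \<not> opposite P u v \<longrightarrow> (\<exists>j\<in>units4. u \<in> P j \<and> v \<in> P (\<i> * j))"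
    proof (intro ballI case_prodI2 impI)
      fix p u v assume "p \<in># arcs D" "p = (u, v)"
      then show "\<exists>j\<in>units4. u \<in> P j \<and> v \<in> P (\<i> * j)"
        using arc[of u v] units[of u] by (intro bexI[of _ "x u"]) (simp_all add: P_def)
    qed
  qed
  then show "\<exists>P. four_partition G D P" by blast
  have "edges (underlying D) = edges G"
  proof (rule multiset_eqI)
    fix p show "count (edges (underlying D)) p = count (edges G) p"
    proof (cases p)
      case (Upair u w)
      show ?thesis
        using sum_g[of u w] loops[of u]
        unfolding Upair count_edges_underlying e_def a_def g_def
        by (cases "u = w") (simp_all only: simp_thms if_True if_False add_0_right)
    qed
  qed
  then show "underlying D = G"
    using G VD by (cases G) (simp add: underlying_def undirected_multigraph_def)
qed

lemma four_partition_switching: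
  assumes D: "delete_orient G D" and U: "underlying D = G" and P: "four_partition G D P"
  obtains x where "\<And>v. v \<in> verts G \<Longrightarrow> x v * cnj (x v) = 1"
    "\<And>u w. u \<in> verts G \<Longrightarrow> w \<in> verts G \<Longrightarrow> H_entry D u w = - (x u * H_entry G u w * cnj (x w))"
proof -
  have VD: "verts D = verts G" and mixed: "mixed_multigraph D"
    using D by (simp_all add: delete_orient_def)
  have arcsG: "arcs G = {#}" using U by (metis underlying_def mixed_multigraph.select_convs(3))
  have PV: "(\<Union>j\<in>units4. P j) = verts G" and disj: "disjoint_family_on P units4"
    and indep: "\<And>j u v. j \<in> units4 \<Longrightarrow> u \<in> P j \<Longrightarrow> v \<in> P j \<Longrightarrow> Upair u v \<notin># edges G"
    and edge: "\<And>u v. Upair u v \<in># edges D \<Longrightarrow> opposite P u v"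
    and arc: "\<And>u v. (u, v) \<in># arcs D \<Longrightarrow> \<exists>j\<in>units4. u \<in> P j \<and> v \<in> P (\<i> * j)"
    using P unfolding four_partition_def VD by blast+
  define x where "x v = (SOME j. j \<in> units4 \<and> v \<in> P j)" for v
  have x: "x v \<in> units4" "v \<in> P (x v)" if "v \<in> verts G" for v
  proof -
    have "\<exists>j. j \<in> units4 \<and> v \<in> P j" using that PV by blast
    from someI_ex[OF this] show "x v \<in> units4" "v \<in> P (x v)" by (simp_all add: x_def)
  qed
  have xj: "x v = j" if "j \<in> units4" "v \<in> P j" for j v
  proof -
    have "v \<in> verts G" using that PV by blast
    then show ?thesis using disj x[of v] that unfolding disjoint_family_on_def by blast
  qed
  have x1: "x v * cnj (x v) = 1" if "v \<in> verts G" for v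
    using x(1)[OF that] by (auto simp: units4_def)
  have arc': "x v = \<i> * x u" if uv: "(u, v) \<in># arcs D" for u v
  proof -
    obtain j where j: "j \<in> units4" "u \<in> P j" "v \<in> P (\<i> * j)" using arc[OF uv] by blast
    moreover have "\<i> * j \<in> units4" using j(1) by (auto simp: units4_def)
    ultimately show ?thesis using xj by auto
  qed
  have edge': "x v = - x u" if "Upair u v \<in># edges D" for u v
    by (rule opposite_phases[OF xj edge[OF that]])
  show ?thesis
  proof (rule that[OF x1])
    fix u w assume u: "u \<in> verts G" and w: "w \<in> verts G"
    define e where "e = count (edges D) (Upair u w)"
    define a where "a = count (arcs D) (u, w)"
    define b where "b = count (arcs D) (w, u)"
    define g where "g = count (edges G) (Upair u w)"
    have HD: "H_entry D u w = of_nat e + \<i> * of_nat a - \<i> * of_nat b"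
      by (simp add: H_entry_def e_def a_def b_def)
    have HG: "H_entry G u w = of_nat g"
      by (simp add: H_entry_def g_def arcsG)
    have e: "x w = - x u" if "e \<noteq> 0" using that edge'[of u w] by (simp only: e_def count_eq_zero_iff not_not)
    have a: "x w = \<i> * x u" if "a \<noteq> 0" using that arc'[of u w] by (simp add: a_def)
    have b: "x u = \<i> * x w" if "b \<noteq> 0" using that arc'[of w u] by (simp add: b_def)
    have gsum: "g = e + a + b"
    proof (cases "u = w")
      case True
      have "a = 0" "b = 0"
        using mixed True by (auto simp: a_def b_def mixed_multigraph_def count_eq_zero_iff)
      moreover have "g = e + a"
        using count_edges_underlying[of D u w] True unfolding U by (simp only: g_def e_def a_def if_True)
          (simp add: \<open>b = 0\<close>[unfolded b_def] \<open>a = 0\<close>[unfolded a_def])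
      ultimately show ?thesis by simp
    next
      case False
      then show ?thesis
        using count_edges_underlying[of D u w] unfolding U
        by (simp only: g_def e_def a_def b_def if_False)
    qed
    have xu: "x u \<noteq> 0" using x1[OF u] by auto
    have c1: "x u * cnj (x u) = 1" "x w * cnj (x w) = 1" using x1 u w by auto
    have ea: "e = 0 \<or> a = 0" using e a imaginary_unit_mult_neq_uminus[OF xu] by (cases "e = 0") auto
    have eb: "e = 0 \<or> b = 0"
    proof (rule ccontr)
      assume "\<not> (e = 0 \<or> b = 0)"
      then have "x w = - x u" and xu': "x u = \<i> * x w" using e b by blast+
      then have "\<i> * x w = - x w" by (metis minus_minus)
      then show False using imaginary_unit_mult_neq_uminus[of "x w"] xu xu' by auto
    qed
    have ab: "a = 0 \<or> b = 0" using a b xu by (cases "a = 0") (auto simp: complex_eq_iff)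
    consider "a = 0" "b = 0" "e \<noteq> 0" | "e = 0" "b = 0" "a \<noteq> 0" | "e = 0" "a = 0" "b \<noteq> 0"
      | "e = 0" "a = 0" "b = 0" using ea eb ab by blast
    then show "H_entry D u w = - (x u * H_entry G u w * cnj (x w))"
    proof cases
      case 1
      then show ?thesis using e c1(1) by (simp add: HD HG gsum algebra_simps)
    next
      case 2
      then show ?thesis using a c1(1) by (simp add: HD HG gsum algebra_simps)
    next
      case 3
      then show ?thesis using b c1(2) by (simp add: HD HG gsum algebra_simps)
    qed (simp add: HD HG gsum)
  qed
qed

lemma H_multiplicity_switching:
  assumes fin: "finite (verts G)" and VD: "verts D = verts G"
    and x1: "\<And>v. v \<in> verts G \<Longrightarrow> x v * cnj (x v) = 1"
    and H: "\<And>u w. u \<in> verts G \<Longrightarrow> w \<in> verts G \<Longrightarrow>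
      H_entry D u w = - (x u * H_entry G u w * cnj (x w))"
  shows "H_multiplicity D (- l) = H_multiplicity G l"
proof -
  define vs n where "vs = vertex_list (verts G)" and "n = card (verts G)"
  have vs: "set vs = verts G" "length vs = n"
    using vertex_list[OF fin] by (simp_all add: vs_def n_def)
  have vsV: "vs ! i \<in> verts G" if "i < n" for i using vs that by (metis nth_mem)
  have A: "H_mat G \<in> carrier_mat n n" "H_mat D \<in> carrier_mat n n"
    using H_mat_carrier[of G] H_mat_carrier[of D] fin VD by (simp_all add: n_def)
  define X Y where "X = mat_diag n (\<lambda>i. x (vs ! i))" and "Y = mat_diag n (\<lambda>i. cnj (x (vs ! i)))"
  have XY: "X \<in> carrier_mat n n" "Y \<in> carrier_mat n n" by (simp_all add: X_def Y_def)
  have "X * Y = 1\<^sub>m n" "Y * X = 1\<^sub>m n"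
    unfolding X_def Y_def mat_diag_diag
    by (intro eq_matI; simp add: mat_diag_def x1 vsV mult.commute[of "cnj _"])+
  moreover have "H_mat D = X * (- H_mat G) * Y"
  proof -
    have "X * (- H_mat G) = Matrix.mat n n (\<lambda>(i, j). x (vs ! i) * (- H_mat G) $$ (i, j))"
      unfolding X_def using A by (intro mat_diag_mult_left) simp
    then have "X * (- H_mat G) * Y
        = Matrix.mat n n (\<lambda>(i, j). (X * (- H_mat G)) $$ (i, j) * cnj (x (vs ! j)))"
      unfolding Y_def by (intro mat_diag_mult_right) simp
    also have "\<dots> = H_mat D"
      using A(1) \<open>X * (- H_mat G) = _\<close> vs
      by (intro eq_matI) (auto simp: H_mat_def H_mat_of_def VD vs_def[symmetric] H vsV)
    finally show ?thesis ..
  qed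
  ultimately have "similar_mat (H_mat D) (- H_mat G)"
    using A XY by (intro similar_matI[where n = n and P = X and Q = Y]) auto
  then have "char_poly (H_mat D) = char_poly (- H_mat G)" by (rule char_poly_similar)
  then show ?thesis by (simp add: H_multiplicity_def order_char_poly_uminus[OF A(1)])
qed

lemma eigenvalue_iff_H_multiplicity:
  assumes "finite (verts D)"
  shows "eigenvalue (H_mat D) x \<longleftrightarrow> H_multiplicity D x \<noteq> 0"
proof -
  have "char_poly (H_mat D) \<noteq> 0"
    using degree_monic_char_poly[OF H_mat_carrier[OF assms]] by auto
  then show ?thesis
    unfolding H_multiplicity_def eigenvalue_root_char_poly[OF H_mat_carrier[OF assms]]
    by (simp add: order_root)
qed

theorem theorem4p2:
  fixes G D :: "'v mixed_multigraph" and n :: nat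
  assumes "undirected_multigraph G"
    and "connected_multigraph G"
    and "delete_orient G D"
    and "n = card (verts D)"
  shows "(H_antispectral G D \<longleftrightarrow> H_eigenvalue 1 G = - H_eigenvalue n D) \<and>
         (H_eigenvalue 1 G = - H_eigenvalue n D \<longleftrightarrow>
            underlying D = G \<and> (\<exists>P. four_partition G D P))"
proof -
  have VD: "verts D = verts G"
    using assms(3) by (simp add: delete_orient_def)
  have fin: "finite (verts G)"
    using assms(1) unfolding undirected_multigraph_def mixed_multigraph_def by blast
  have "verts G \<noteq> {}" using assms(2) by (simp add: connected_multigraph_def)
  then have n: "1 \<le> n" using fin assms(4) VD by (simp add: Suc_le_eq card_gt_0_iff)
  have evD: "eigenvalue (H_mat D) (complex_of_real (H_eigenvalue n D))"
    using fin n assms(4) VD by (intro H_eigenvalue_is_eigenvalue) auto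
  have ab: "H_eigenvalue 1 G = - H_eigenvalue n D" if "H_antispectral G D"
  proof -
    have "eigenvalue (H_mat G) (complex_of_real (H_eigenvalue 1 G))"
      using fin n assms(4) VD by (intro H_eigenvalue_is_eigenvalue) auto
    then have "eigenvalue (H_mat D) (complex_of_real (- H_eigenvalue 1 G))"
      using that by (simp add: H_antispectral_def)
    then have "H_eigenvalue n D \<le> - H_eigenvalue 1 G"
      unfolding assms(4) by (intro eigenvalue_between) (simp_all add: VD fin)
    moreover have "\<bar>H_eigenvalue n D\<bar> \<le> H_eigenvalue 1 G"
      by (rule abs_eigenvalue_le_H_eigenvalue_1[OF assms(1,3) evD])
    ultimately show ?thesis by linarith
  qed
  have bc: "underlying D = G \<and> (\<exists>P. four_partition G D P)" if "H_eigenvalue 1 G = - H_eigenvalue n D"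
    using extremal_eigenvalue_four_partition[OF assms(1-3)] evD that by simp
  have ca: "H_antispectral G D" if U: "underlying D = G" and P: "four_partition G D P" for P
  proof -
    obtain x where x: "\<And>v. v \<in> verts G \<Longrightarrow> x v * cnj (x v) = 1"
      "\<And>u w. u \<in> verts G \<Longrightarrow> w \<in> verts G \<Longrightarrow> H_entry D u w = - (x u * H_entry G u w * cnj (x w))"
      using four_partition_switching[OF assms(3) U P] by blast
    have "H_multiplicity D (- l) = H_multiplicity G l" for l
      by (rule H_multiplicity_switching[OF fin VD x])
    then show ?thesis
      using fin by (simp add: H_antispectral_def VD eigenvalue_iff_H_multiplicity)
  qed
  show ?thesis using ab bc ca by blast
qed

end
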